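(* Let $b\in\mathbb{R}$, $c\ge 0$, let $m$ be a measure on $(0,\infty)$ with $\int_0^\infty (z\wedge z^2)\,m(dz)<\infty$, let $\pi$ be a $\sigma$-finite measure on $(0,\infty)$, and let $\beta:[0,\infty)\to[0,\infty)$ and $q:[0,\infty)\times(0,\infty)\to[0,\infty)$ be Borel functions satisfying the Standing Assumptions (S1)–(S2) below. Define $$R(\lambda)=b\lambda+c\lambda^2+\int_0^\infty(e^{-\lambda z}-1+\lambda z)\,m(dz),\qquad F(\lambda,x)=-\beta(x)\lambda+\int_0^\infty(e^{-\lambda z}-1)\,q(x,z)\,\pi(dz).$$ Then there exist a sequence of positive constants $\gamma_k\uparrow\infty$, probability generating functions $g_k$ (on $\mathbb{N}$) and probability generating functions $h_k^{(i)}$, $i\in\mathbb{N}$, $k\ge1$, such that the functions $R_k$ and $F_k$ defined by $$R_k(\lambda)=k\gamma_k\big[g_k(1-\lambda/k)-(1-\lambda/k)\big],\qquad F_k(\lambda,x)=\gamma_k\big[h_k^{(\lfloor kx\rfloor)}(1-\lambda/k)-(1-\lambda/k)\big],\quad 0\le\lambda\le k,\ x\ge0,$$ satisfy conditions (A), (B) and (C) below.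
   Context: Standing Assumptions on $(\beta,q,\pi)$: (S1) there is a constant $K\ge0$ with $|\beta(x)|+\int_0^\infty q(x,z)\,z\,\pi(dz)\le K(1+x)$ for all $x\ge0$; (S2) there is a non-decreasing concave function $r:[0,\infty)\to[0,\infty)$ with $\int_{0+}r(z)^{-1}dz=\infty$ such that $|\beta(x)-\beta(y)|+\int_0^\infty|q(x,z)-q(y,z)|\,z\,\pi(dz)\le r(|x-y|)$ for all $x,y\ge0$. Conditions: (A) the sequence $(R_k)$ is uniformly Lipschitz on each bounded interval and converges to $R$ as $k\to\infty$; (B) for all $a_1,a_2>0$, $F_k(\lambda,x)\to F(\lambda,x)$ uniformly on $[0,a_1]\times[0,a_2]$ as $k\to\infty$; (C) there is a constant $K_1>0$ with $\big|\frac{\partial F_k}{\partial\lambda}(0,x)\big|=\frac{\gamma_k}{k}\,(h_k^{(\lfloor kx\rfloor)})'(1-)\le K_1(1+x)$ for all $x\ge0$, $k\ge1$.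
   Formalization: In (C) only the bound (γ_k/k)(h_k^{(⌊kx⌋)})'(1−) ≤ K_1(1+x) is stated; the displayed equality with |∂F_k/∂λ(0,x)| is dropped, since for the given F_k that derivative is (γ_k/k)(1−h'(1−)) and the equality fails. *)

theory Defs
  imports "HOL-Probability.Probability"
begin

definition pgf :: "nat pmf \<Rightarrow> real \<Rightarrow> real" where
  "pgf p s = (\<Sum>n. pmf p n * s ^ n)"

text \<open>Left derivative g'(1-) of the generating function of p at 1, i.e. the
  (possibly infinite) mean sum_n n p_n, as an extended nonnegative real.\<close>
definition pgf_left_deriv_1 :: "nat pmf \<Rightarrow> ennreal" where
  "pgf_left_deriv_1 p = (\<Sum>n. ennreal (real n * pmf p n))"

definition Rfun :: "real \<Rightarrow> real \<Rightarrow> real measure \<Rightarrow> real \<Rightarrow> real" where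
  "Rfun b c m l = b * l + c * l^2 + (LINT z:{0<..}|m. exp (- l * z) - 1 + l * z)"

definition Ffun :: "(real \<Rightarrow> real) \<Rightarrow> (real \<Rightarrow> real \<Rightarrow> real) \<Rightarrow> real measure
    \<Rightarrow> real \<Rightarrow> real \<Rightarrow> real" where
  "Ffun \<beta> q \<pi> l x = - \<beta> x * l + (LINT z:{0<..}|\<pi>. (exp (- l * z) - 1) * q x z)"

definition Rk :: "(nat \<Rightarrow> real) \<Rightarrow> (nat \<Rightarrow> nat pmf) \<Rightarrow> nat \<Rightarrow> real \<Rightarrow> real" where
  "Rk \<gamma> g k l = real k * \<gamma> k * (pgf (g k) (1 - l / real k) - (1 - l / real k))"

definition Fk :: "(nat \<Rightarrow> real) \<Rightarrow> (nat \<Rightarrow> nat \<Rightarrow> nat pmf) \<Rightarrow> nat \<Rightarrow> real \<Rightarrow> real \<Rightarrow> real" where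
  "Fk \<gamma> h k l x = \<gamma> k * (pgf (h k (nat \<lfloor>real k * x\<rfloor>)) (1 - l / real k) - (1 - l / real k))"

end

theory Submission
  imports Defs
begin

text \<open>
  Take \<open>\<gamma>\<^sub>k = C k\<close> with a large constant \<open>C\<close>. With \<open>s = 1 - \<lambda>/k\<close>, the number \<open>exp (-\<lambda> z)\<close> is the value
  at \<open>s\<close> of the Poisson generating function with mean \<open>k z\<close>, so mixtures of Poisson distributions
  realise the jump parts of both mechanisms. For the branching mechanism one perturbs the point mass
  at 1, and integrability of \<open>z \<and> z\<^sup>2\<close> is exactly what keeps the weight at 1 nonnegative; the resulting
  \<open>R\<^sub>k\<close> equals \<open>R\<close> up to \<open>max 0 (-b) \<lambda>\<^sup>2/k\<close>.

  For immigration one perturbs the point mass at 0. The term \<open>\<gamma>\<^sub>k \<lambda>/k = C \<lambda>\<close> in \<open>F\<^sub>k\<close> is absorbed by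
  enlarging the drift \<open>\<beta>\<close> to \<open>\<beta> + C\<close>. The total jump rate must not exceed \<open>\<gamma>\<^sub>k\<close>, so jumps of size
  below \<open>\<delta>\<^sub>k = 1 / sqrt k\<close> (and the drift) are replaced by jumps of size \<open>\<delta>\<^sub>k\<close> with the same mean; where the
  rate is still too large, which for bounded \<open>x\<close> happens only for small \<open>k\<close>, there is no immigration
  at all. Replacing \<open>x\<close> by \<open>\<lfloor>k x\<rfloor>/k\<close> costs at most \<open>\<lambda> r (1/k)\<close>, and divergence of the integral of
  \<open>1/r\<close> at 0 forces \<open>r\<close> to take arbitrarily small values near 0.
\<close>

subsection \<open>Perturbing a point mass\<close>

text \<open>The signed sequence \<open>d\<close> is what has to be added to the point mass at \<open>j\<close>: if moreover
  \<open>d j \<ge> -1\<close>, the result is a probability distribution with generating function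
  \<open>s ^ j + D s\<close>.\<close>

definition pgf_perturbation :: "nat \<Rightarrow> (nat \<Rightarrow> real) \<Rightarrow> (real \<Rightarrow> real) \<Rightarrow> bool" where
  "pgf_perturbation j d D \<longleftrightarrow>
     (\<forall>n. n \<noteq> j \<longrightarrow> 0 \<le> d n) \<and> (\<forall>s\<in>{0..1}. (\<lambda>n. d n * s ^ n) sums D s) \<and> D 1 = 0"

lemma pgf_perturbation_add:
  assumes "pgf_perturbation j d D" "pgf_perturbation j e E"
  shows "pgf_perturbation j (\<lambda>n. d n + e n) (\<lambda>s. D s + E s)"
  using assms unfolding pgf_perturbation_def by (auto intro: sums_add simp: distrib_right)

lemma pgf_perturbation_cmult:
  assumes "pgf_perturbation j d D" "0 \<le> a"
  shows "pgf_perturbation j (\<lambda>n. a * d n) (\<lambda>s. a * D s)"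
  using assms unfolding pgf_perturbation_def by (auto intro: sums_mult simp: mult.assoc)

lemma pgf_perturbation_pmf:
  assumes "pgf_perturbation j d D" "-1 \<le> d j"
  obtains p where "\<And>s. s \<in> {0..1} \<Longrightarrow> pgf p s = s ^ j + D s"
proof -
  define p where "p n = (if n = j then 1 else 0) + d n" for n
  have nn: "0 \<le> p n" for n
    using assms by (cases "n = j") (auto simp: p_def pgf_perturbation_def)
  have sums: "(\<lambda>n. p n * s ^ n) sums (s ^ j + D s)" if "s \<in> {0..1}" for s
  proof -
    have "(\<lambda>n. if n = j then s ^ n else 0) sums s ^ j"
      by (rule sums_single)
    moreover have "(\<lambda>n. d n * s ^ n) sums D s"
      using assms that by (auto simp: pgf_perturbation_def)
    ultimately have "(\<lambda>n. (if n = j then s ^ n else 0) + d n * s ^ n) sums (s ^ j + D s)"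
      by (rule sums_add)
    moreover have "(\<lambda>n. (if n = j then s ^ n else 0) + d n * s ^ n) = (\<lambda>n. p n * s ^ n)"
      by (auto simp: p_def fun_eq_iff algebra_simps)
    ultimately show ?thesis by simp
  qed
  have "p sums 1"
    using sums[of 1] assms by (simp add: pgf_perturbation_def)
  then have "(\<Sum>n. ennreal (p n)) = 1"
    using suminf_ennreal_eq[OF nn] by simp
  then have "(\<integral>\<^sup>+ n. ennreal (p n) \<partial>count_space UNIV) = 1"
    by (simp add: nn_integral_count_space_nat)
  then have pmf: "pmf (embed_pmf p) n = p n" for n
    using nn by (intro pmf_embed_pmf)
  show thesis
    by (rule that[of "embed_pmf p"]) (use sums in \<open>simp add: pgf_def pmf sums_iff\<close>)
qed

text \<open>Since \<open>D 1 = 0\<close>, the entries sum to 0, and only \<open>d j\<close> can be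
  negative; hence the remaining entries sum to \<open>- d j\<close>. The single entry at
  \<open>j\<close> thus controls the whole sequence, which provides the dominating function for
  mixtures.\<close>

lemma pgf_perturbation_sum_abs_le:
  assumes "pgf_perturbation j d D"
  shows "(\<Sum>n<i. \<bar>d n\<bar>) \<le> 2 * \<bar>d j\<bar>"
proof -
  define e where "e n = (if n = j then 0 else d n)" for n
  have "d sums 0"
    using assms unfolding pgf_perturbation_def by (auto dest!: bspec[of _ _ 1])
  then have "(\<lambda>n. d n - (if n = j then d n else 0)) sums (0 - d j)"
    by (intro sums_diff sums_single)
  moreover have "(\<lambda>n. d n - (if n = j then d n else 0)) = e"
    by (auto simp: e_def)
  ultimately have e: "e sums (- d j)" by simp
  have e0: "0 \<le> e n" for n using assms by (auto simp: e_def pgf_perturbation_def)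
  have le: "sum e {..<i} \<le> - d j"
    using sum_le_suminf[of e "{..<i}"] e e0 by (auto simp: sums_iff)
  have "(\<Sum>n<i. \<bar>d n\<bar>) = (\<Sum>n<i. e n + (if n = j then \<bar>d n\<bar> else 0))"
    using assms by (intro sum.cong) (auto simp: e_def pgf_perturbation_def)
  also have "\<dots> \<le> - d j + \<bar>d j\<bar>"
    using le by (auto simp: sum.distrib sum.delta)
  finally show ?thesis by linarith
qed

text \<open>Dominated convergence for the partial sums with majorant
  \<open>2 * \<bar>d z j\<bar>\<close>: integrability of the one entry at \<open>j\<close> makes
  every entry integrable and lets sum and integral be exchanged. The measure \<open>N\<close> may be
  infinite, which matters for jump measures that are infinite near 0.\<close>

lemma pgf_perturbation_integral:
  fixes d :: "'a \<Rightarrow> nat \<Rightarrow> real"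
  assumes pert: "\<And>z. z \<in> space N \<Longrightarrow> pgf_perturbation j (d z) (D z)"
    and meas: "\<And>n. (\<lambda>z. d z n) \<in> borel_measurable N"
    and int: "integrable N (\<lambda>z. d z j)"
  shows "pgf_perturbation j (\<lambda>n. \<integral>z. d z n \<partial>N) (\<lambda>s. \<integral>z. D z s \<partial>N)"
proof -
  have bound: "(\<Sum>n<i. \<bar>d z n\<bar>) \<le> 2 * \<bar>d z j\<bar>" if "z \<in> space N" for z i
    using pgf_perturbation_sum_abs_le[OF pert[OF that]] .
  have intb: "integrable N (\<lambda>z. 2 * \<bar>d z j\<bar>)"
    using int by simp
  have intd: "integrable N (\<lambda>z. d z n)" for n
  proof (rule Bochner_Integration.integrable_bound[OF intb meas], rule AE_I2)
    fix z assume z: "z \<in> space N"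
    have "\<bar>d z n\<bar> \<le> (\<Sum>i<Suc n. \<bar>d z i\<bar>)"
      by (rule member_le_sum) auto
    then show "norm (d z n) \<le> norm (2 * \<bar>d z j\<bar>)"
      using bound[OF z, of "Suc n"] by (simp del: sum.lessThan_Suc)
  qed
  have lim: "(\<lambda>n. (\<integral>z. d z n \<partial>N) * s ^ n) sums (\<integral>z. D z s \<partial>N)" if s: "s \<in> {0..1}" for s
  proof -
    have conv: "(\<lambda>i. \<Sum>n<i. d z n * s ^ n) \<longlonglongrightarrow> D z s" if "z \<in> space N" for z
      using pert[OF that] s by (auto simp: pgf_perturbation_def sums_def)
    have meas_sum: "(\<lambda>z. \<Sum>n<i. d z n * s ^ n) \<in> borel_measurable N" for i
      using meas by measurable
    have "(\<lambda>i. \<integral>z. (\<Sum>n<i. d z n * s ^ n) \<partial>N) \<longlonglongrightarrow> (\<integral>z. D z s \<partial>N)"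
    proof (rule integral_dominated_convergence[OF _ meas_sum intb])
      show "(\<lambda>z. D z s) \<in> borel_measurable N"
        using conv meas_sum by (rule borel_measurable_LIMSEQ_real)
      show "AE z in N. (\<lambda>i. \<Sum>n<i. d z n * s ^ n) \<longlonglongrightarrow> D z s"
        using conv by (rule AE_I2)
      show "AE z in N. norm (\<Sum>n<i. d z n * s ^ n) \<le> 2 * \<bar>d z j\<bar>" for i
      proof (rule AE_I2)
        fix z assume z: "z \<in> space N"
        have "norm (\<Sum>n<i. d z n * s ^ n) \<le> (\<Sum>n<i. \<bar>d z n\<bar>)"
          using s by (intro order.trans[OF norm_sum] sum_mono)
            (auto simp: abs_mult mult_left_le power_le_one)
        then show "norm (\<Sum>n<i. d z n * s ^ n) \<le> 2 * \<bar>d z j\<bar>"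
          using bound[OF z, of i] by linarith
      qed
    qed
    moreover have "(\<integral>z. (\<Sum>n<i. d z n * s ^ n) \<partial>N) = (\<Sum>n<i. (\<integral>z. d z n \<partial>N) * s ^ n)" for i
      using intd by (subst Bochner_Integration.integral_sum) auto
    ultimately show ?thesis by (simp add: sums_def)
  qed
  have "0 \<le> (\<integral>z. d z n \<partial>N)" if "n \<noteq> j" for n
    using pert that by (intro integral_nonneg_AE AE_I2) (auto simp: pgf_perturbation_def)
  moreover have "(\<integral>z. D z 1 \<partial>N) = 0"
    using pert by (subst Bochner_Integration.integral_cong[OF refl, of _ _ "\<lambda>_. 0"])
      (auto simp: pgf_perturbation_def)
  ultimately show "pgf_perturbation j (\<lambda>n. \<integral>z. d z n \<partial>N) (\<lambda>s. \<integral>z. D z s \<partial>N)"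
    using lim by (simp add: pgf_perturbation_def)
qed

section \<open>Elementary perturbations: Poisson jumps, deaths and binary splitting\<close>

definition poisson_perturbation :: "real \<Rightarrow> nat \<Rightarrow> real" where
  "poisson_perturbation u n = exp (- u) * (u ^ n / fact n) - (if n = 0 then 1 else 0)"

lemma poisson_perturbation_sums:
  "(\<lambda>n. poisson_perturbation u n * s ^ n) sums (exp (- u * (1 - s)) - 1)"
proof -
  have "(\<lambda>n. (u * s) ^ n /\<^sub>R fact n) sums exp (u * s)"
    by (rule exp_converges)
  then have "(\<lambda>n. exp (- u) * ((u * s) ^ n /\<^sub>R fact n)) sums (exp (- u) * exp (u * s))"
    by (rule sums_mult)
  moreover have "(\<lambda>n. if n = 0 then 1 else 0) sums (1::real)"
    using sums_single[of 0 "\<lambda>_. 1::real"] by simp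
  ultimately have "(\<lambda>n. exp (- u) * ((u * s) ^ n /\<^sub>R fact n) - (if n = 0 then 1 else 0))
      sums (exp (- u) * exp (u * s) - 1)"
    by (rule sums_diff)
  moreover have "exp (- u) * exp (u * s) = exp (- u * (1 - s))"
    by (simp add: algebra_simps flip: exp_add)
  moreover have "(\<lambda>n. exp (- u) * ((u * s) ^ n /\<^sub>R fact n) - (if n = 0 then 1 else 0))
      = (\<lambda>n. poisson_perturbation u n * s ^ n)"
    by (auto simp: poisson_perturbation_def fun_eq_iff power_mult_distrib field_simps)
  ultimately show ?thesis by simp
qed

lemma poisson_perturbation:
  "0 \<le> u \<Longrightarrow> pgf_perturbation 0 (poisson_perturbation u) (\<lambda>s. exp (- u * (1 - s)) - 1)"
  using poisson_perturbation_sums by (auto simp: pgf_perturbation_def)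
    (auto simp: poisson_perturbation_def)

lemma linear_perturbation_sums:
  "(\<lambda>n. (if n = 0 then 1 else if n = 1 then - 1 else 0) * s ^ n) sums (1 - s :: real)"
  using sums_finite[of "{..1::nat}" "\<lambda>n. (if n = 0 then 1 else if n = 1 then - 1 else 0) * s ^ n"]
  by (simp add: atMost_Suc)

lemma linear_perturbation:
  "pgf_perturbation 1 (\<lambda>n. if n = 0 then 1 else if n = 1 then - 1 else 0) (\<lambda>s. 1 - s)"
  using linear_perturbation_sums by (auto simp: pgf_perturbation_def)

text \<open>Mass moves from 1 to 2. At \<open>s = 1 - l / k\<close> the value is
  \<open>- (l / k) + (l / k)\<^sup>2\<close>, a negative drift with a second-order error.\<close>

lemma binary_branching_perturbation:
  "pgf_perturbation 1 (\<lambda>n. if n = 2 then 1 else if n = 1 then - 1 else 0) (\<lambda>s. s\<^sup>2 - s)"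
  using sums_finite[of "{..2::nat}" "\<lambda>n. (if n = 2 then 1 else if n = 1 then - 1 else 0) * s ^ n" for s :: real]
  by (simp add: pgf_perturbation_def numeral_2_eq_2 atMost_Suc)

text \<open>Critical binary branching: mass leaves 1 in equal parts for 0 and 2. It produces the
  term \<open>c * l\<^sup>2\<close> without error.\<close>

lemma quadratic_perturbation:
  "pgf_perturbation 1 (\<lambda>n. if n = 1 then - 2 else if n \<le> 2 then 1 else 0) (\<lambda>s. (1 - s)\<^sup>2)"
  using sums_finite[of "{..2::nat}" "\<lambda>n. (if n = 1 then - 2 else if n \<le> 2 then 1 else 0) * s ^ n" for s :: real]
  by (simp add: pgf_perturbation_def numeral_2_eq_2 atMost_Suc power2_eq_square algebra_simps)

text \<open>Adding \<open>u\<close> times the death perturbation moves the negative entry from 0 to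
  1: the entry at 0 becomes \<open>exp (- u) - 1 + u\<close>, and the one at 1 becomes
  \<open>- u * (1 - exp (- u))\<close>. The latter is bounded in modulus by both \<open>u\<close>
  and \<open>u\<^sup>2\<close>, so it can be integrated against \<open>m\<close>.\<close>

definition compensated_poisson_perturbation :: "real \<Rightarrow> nat \<Rightarrow> real" where
  "compensated_poisson_perturbation u n =
     poisson_perturbation u n + u * (if n = 0 then 1 else if n = 1 then - 1 else 0)"

lemma compensated_poisson_perturbation:
  assumes "0 \<le> u"
  shows "pgf_perturbation 1 (compensated_poisson_perturbation u)
    (\<lambda>s. exp (- u * (1 - s)) - 1 + u * (1 - s))"
proof -
  have "(\<lambda>n. compensated_poisson_perturbation u n * s ^ n) sums
      (exp (- u * (1 - s)) - 1 + u * (1 - s))" for s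
    using sums_add[OF poisson_perturbation_sums[of u s] sums_mult[OF linear_perturbation_sums[of s], of u]]
    unfolding compensated_poisson_perturbation_def by (simp add: distrib_right mult.assoc)
  moreover have "0 \<le> compensated_poisson_perturbation u n" if "n \<noteq> 1" for n
    using that assms exp_ge_add_one_self[of "- u"]
    by (auto simp: compensated_poisson_perturbation_def poisson_perturbation_def)
  ultimately show ?thesis by (simp add: pgf_perturbation_def)
qed

section \<open>The mean as a limit of chord slopes\<close>

lemma pgf_left_deriv_1_le:
  assumes "\<And>s. 0 \<le> s \<Longrightarrow> s < 1 \<Longrightarrow> 1 - pgf p s \<le> L * (1 - s)"
  shows "pgf_left_deriv_1 p \<le> ennreal L"
proof -
  have tot: "(\<Sum>n. ennreal (pmf p n)) = 1"
    using nn_integral_pmf_eq_1[of p] by (simp add: nn_integral_count_space_nat)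
  have summ: "summable (pmf p)"
    by (rule summable_suminf_not_top) (simp_all add: tot)
  have "ennreal (suminf (pmf p)) = 1"
    using suminf_ennreal2[OF pmf_nonneg summ] tot by metis
  then have one: "pmf p sums 1"
    using summable_sums[OF summ] by (simp only: ennreal_eq_1)
  \<comment> \<open>Factoring \<open>1 - s ^ n = (1 - s) * (\<Sum>i<n. s ^ i)\<close> and cancelling
    \<open>1 - s\<close> bounds a finite sum, in which \<open>s\<close> can be sent to 1 termwise.
    Working with partial sums avoids assuming that the mean is finite.\<close>
  have part: "(\<Sum>n<N. real n * pmf p n) \<le> L" for N
  proof -
    have *: "(\<Sum>n<N. pmf p n * (\<Sum>i<n. s ^ i)) \<le> L" if s: "0 \<le> s" "s < 1" for s
    proof -
      have "summable (\<lambda>n. pmf p n * s ^ n)"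
        by (rule summable_comparison_test'[OF summ, of 0])
          (simp add: s(1) s(2)[THEN less_imp_le] abs_mult mult_left_le power_le_one)
      then have "(\<lambda>n. pmf p n - pmf p n * s ^ n) sums (1 - pgf p s)"
        using one unfolding pgf_def by (intro sums_diff) (auto simp: summable_sums)
      then have sub: "summable (\<lambda>n. pmf p n - pmf p n * s ^ n)"
        and eq: "(\<Sum>n. pmf p n - pmf p n * s ^ n) = 1 - pgf p s"
        by (simp_all only: sums_iff)
      have "(\<Sum>n<N. pmf p n - pmf p n * s ^ n) \<le> 1 - pgf p s"
        unfolding eq[symmetric]
        by (rule sum_le_suminf[OF sub]) (simp_all add: s(1) s(2)[THEN less_imp_le] mult_left_le power_le_one)
      also have "\<dots> \<le> L * (1 - s)" using assms s by simp
      also have "(\<Sum>n<N. pmf p n - pmf p n * s ^ n) = (\<Sum>n<N. pmf p n * (\<Sum>i<n. s ^ i)) * (1 - s)"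
      proof -
        have "a - a * x = a * y * (1 - s)" if "1 - x = (1 - s) * y" for a x y :: real
          using that by algebra
        then show ?thesis
          unfolding sum_distrib_right using one_diff_power_eq[of s] by (intro sum.cong refl) blast
      qed
      finally show ?thesis using s by (simp only: mult_le_cancel_right)
    qed
    have "((\<lambda>s. \<Sum>n<N. pmf p n * (\<Sum>i<n. s ^ i)) \<longlongrightarrow> (\<Sum>n<N. pmf p n * (\<Sum>i<n. 1 ^ i))) (at_left 1)"
      by (intro tendsto_intros)
    moreover have "\<forall>\<^sub>F s in at_left (1::real). (\<Sum>n<N. pmf p n * (\<Sum>i<n. s ^ i)) \<le> L"
      by (rule eventually_mono[OF eventually_at_left_real[of 0 "1::real"]]) (auto intro: *)
    ultimately have "(\<Sum>n<N. pmf p n * (\<Sum>i<n. 1 ^ i)) \<le> L"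
      by (rule tendsto_upperbound) simp
    then show ?thesis by (simp add: mult.commute)
  qed
  show ?thesis
    unfolding pgf_left_deriv_1_def
  proof (rule suminf_le_const)
    show "(\<Sum>i<n. ennreal (real i * pmf p i)) \<le> ennreal L" for n
      using part[of n] by (simp add: sum_ennreal ennreal_leI)
  qed simp
qed

subsection \<open>Immigration\<close>

text \<open>With \<open>f x z = z q x z\<close>, the jump part of \<open>-F\<close> is the integral of
  \<open>exp_slope l z * f x z\<close>, where the weight stays below \<open>l\<close> and \<open>f x\<close> is integrable.\<close>

definition exp_slope :: "real \<Rightarrow> real \<Rightarrow> real" where
  "exp_slope l z = (1 - exp (- l * z)) / z"

text \<open>The second estimate comes from
  \<open>(1 - x + x\<^sup>2) * (1 + x) = 1 + x ^ 3\<close>.\<close>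

lemma exp_minus_le_quadratic:
  fixes x :: real
  assumes "0 \<le> x"
  shows "exp (- x) \<le> 1 - x + x\<^sup>2"
proof -
  have "exp (- x) \<le> inverse (1 + x)"
    using exp_ge_add_one_self[of x] assms by (simp add: exp_minus le_imp_inverse_le)
  also have "\<dots> \<le> 1 - x + x\<^sup>2"
  proof -
    have "1 \<le> (1 - x + x\<^sup>2) * (1 + x)"
      using assms by (simp add: algebra_simps power2_eq_square)
    then show ?thesis using assms by (simp add: field_simps)
  qed
  finally show ?thesis .
qed

text \<open>The bound by \<open>l\<close> gives integrability and the mean estimate, the lower bound
  \<open>l - l\<^sup>2 * z\<close> measures the error of changing small jump sizes, and the bound by
  \<open>inverse z\<close> limits the total jump rate.\<close>

lemma exp_slope_bounds:
  assumes "0 \<le> l" "0 < z"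
  shows "0 \<le> exp_slope l z" "exp_slope l z \<le> l" "l - l\<^sup>2 * z \<le> exp_slope l z"
    "exp_slope l z \<le> inverse z"
proof -
  show "0 \<le> exp_slope l z"
    using assms by (simp add: exp_slope_def)
  show "exp_slope l z \<le> l"
    using exp_ge_add_one_self[of "- l * z"] assms by (simp add: exp_slope_def field_simps)
  show "exp_slope l z \<le> inverse z"
    using assms by (simp add: exp_slope_def field_simps)
  have "exp (- (l * z)) \<le> 1 - l * z + (l * z)\<^sup>2"
    using assms by (intro exp_minus_le_quadratic) simp
  then show "l - l\<^sup>2 * z \<le> exp_slope l z"
    using assms by (simp add: exp_slope_def field_simps power2_eq_square)
qed

lemma exp_slope_measurable [measurable]: "exp_slope l \<in> borel_measurable borel"
  unfolding exp_slope_def[abs_def] by measurable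

lemma integrable_exp_slope_max:
  assumes N: "sets N = sets borel" and f: "integrable N f" and l: "0 \<le> l" and \<delta>: "0 < \<delta>"
  shows "integrable N (\<lambda>z. exp_slope l (max z \<delta>) * f z)"
proof (rule Bochner_Integration.integrable_bound)
  show "integrable N (\<lambda>z. l * f z)" using f by simp
  show "(\<lambda>z. exp_slope l (max z \<delta>) * f z) \<in> borel_measurable N"
    using f by (intro borel_measurable_times) (auto simp: measurable_cong_sets[OF N refl])
  show "AE z in N. norm (exp_slope l (max z \<delta>) * f z) \<le> norm (l * f z)"
    using exp_slope_bounds[OF l] l \<delta> by (intro AE_I2) (auto simp: abs_mult intro!: mult_right_mono)
qed

lemma integrable_exp_slope:
  assumes N: "sets N = sets borel" and f: "integrable N f" and l: "0 \<le> l"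
    and f0: "\<And>z. z \<le> 0 \<Longrightarrow> f z = 0"
  shows "integrable N (\<lambda>z. exp_slope l z * f z)"
proof (rule Bochner_Integration.integrable_bound)
  show "integrable N (\<lambda>z. l * f z)" using f by simp
  show "(\<lambda>z. exp_slope l z * f z) \<in> borel_measurable N"
    using f by (intro borel_measurable_times) (auto simp: measurable_cong_sets[OF N refl])
  have "norm (exp_slope l z * f z) \<le> norm (l * f z)" for z
    using exp_slope_bounds[OF l, of z] l f0[of z]
    by (cases "0 < z") (auto simp: abs_mult intro!: mult_right_mono)
  then show "AE z in N. norm (exp_slope l z * f z) \<le> norm (l * f z)" by simp
qed

text \<open>The drift \<open>a\<close> and all jumps shorter than \<open>\<delta>\<close> become
  jumps of size \<open>\<delta>\<close> with unchanged mean. For sizes in the interval from 0 to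
  \<open>\<delta>\<close> the slope lies between \<open>l - l\<^sup>2 * \<delta>\<close> and
  \<open>l\<close>, so each unit of mean costs at most \<open>l\<^sup>2 * \<delta>\<close>.\<close>

lemma exp_slope_max_error:
  assumes N: "sets N = sets borel" and f: "integrable N f" and l: "0 \<le> l" and \<delta>: "0 < \<delta>"
    and f0: "\<And>z. z \<le> 0 \<Longrightarrow> f z = 0" and nn: "\<And>z. 0 \<le> f z" and a: "0 \<le> a"
  shows "\<bar>(exp_slope l \<delta> * a + (\<integral>z. exp_slope l (max z \<delta>) * f z \<partial>N)) -
      (l * a + (\<integral>z. exp_slope l z * f z \<partial>N))\<bar> \<le> l\<^sup>2 * \<delta> * (a + integral\<^sup>L N f)"
proof -
  note int = integrable_exp_slope_max[OF N f l \<delta>] integrable_exp_slope[OF N f l f0]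
  have le: "\<bar>exp_slope l (max z \<delta>) * f z - exp_slope l z * f z\<bar> \<le> l\<^sup>2 * \<delta> * f z" for z
  proof (cases "0 < z \<and> z < \<delta>")
    case True
    have "l\<^sup>2 * z \<le> l\<^sup>2 * \<delta>"
      using True by (intro mult_left_mono) auto
    then have "\<bar>exp_slope l \<delta> - exp_slope l z\<bar> \<le> l\<^sup>2 * \<delta>"
      using True exp_slope_bounds[OF l, of \<delta>] exp_slope_bounds[OF l, of z] \<delta> by auto
    then have "\<bar>exp_slope l \<delta> - exp_slope l z\<bar> * f z \<le> l\<^sup>2 * \<delta> * f z"
      using nn by (intro mult_right_mono)
    then show ?thesis
      using True nn[of z] by (simp add: max_def abs_mult flip: left_diff_distrib)
  next
    case False
    then show ?thesis using f0[of z] nn[of z] \<delta> l by (cases "0 < z") (auto simp: max_def)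
  qed
  have "\<bar>(\<integral>z. exp_slope l (max z \<delta>) * f z \<partial>N) - (\<integral>z. exp_slope l z * f z \<partial>N)\<bar>
      = \<bar>\<integral>z. exp_slope l (max z \<delta>) * f z - exp_slope l z * f z \<partial>N\<bar>"
    using int by simp
  also have "\<dots> \<le> (\<integral>z. \<bar>exp_slope l (max z \<delta>) * f z - exp_slope l z * f z\<bar> \<partial>N)"
    using integral_abs_bound .
  also have "\<dots> \<le> (\<integral>z. l\<^sup>2 * \<delta> * f z \<partial>N)"
    using int f le by (intro integral_mono) auto
  finally have 1: "\<bar>(\<integral>z. exp_slope l (max z \<delta>) * f z \<partial>N) - (\<integral>z. exp_slope l z * f z \<partial>N)\<bar>
      \<le> l\<^sup>2 * \<delta> * integral\<^sup>L N f" by simp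
  have "\<bar>exp_slope l \<delta> - l\<bar> \<le> l\<^sup>2 * \<delta>"
    using exp_slope_bounds[OF l \<delta>] by auto
  then have "\<bar>exp_slope l \<delta> - l\<bar> * a \<le> l\<^sup>2 * \<delta> * a"
    using a by (rule mult_right_mono)
  then have 2: "\<bar>exp_slope l \<delta> * a - l * a\<bar> \<le> l\<^sup>2 * \<delta> * a"
    using a by (simp add: abs_mult flip: left_diff_distrib)
  show ?thesis
    using 1 2 unfolding distrib_left[of _ a] by linarith
qed

text \<open>Jumps of size \<open>max z \<delta>\<close> arrive at rate
  \<open>f z / max z \<delta>\<close>, and the drift becomes jumps of size \<open>\<delta>\<close>
  at rate \<open>a / \<delta>\<close>; a jump of size \<open>u\<close> brings a Poisson number of
  immigrants with mean \<open>\<kappa> * u\<close>. Every size is at least \<open>\<delta>\<close>,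
  so the total rate is at most \<open>(a + integral\<^sup>L N f) / \<delta>\<close>, which the
  hypothesis keeps below \<open>\<gamma>\<close>.\<close>

lemma immigration_pmf:
  assumes N: "sets N = sets borel" and f: "integrable N f" and \<kappa>: "0 \<le> \<kappa>" and \<delta>: "0 < \<delta>"
    and nn: "\<And>z. 0 \<le> f z" and a: "0 \<le> a" and \<gamma>: "0 < \<gamma>" "a + integral\<^sup>L N f \<le> \<gamma> * \<delta>"
  obtains p where
    "\<And>s. s \<in> {0..1} \<Longrightarrow> \<gamma> * (1 - pgf p s) = exp_slope (\<kappa> * (1 - s)) \<delta> * a
      + (\<integral>z. exp_slope (\<kappa> * (1 - s)) (max z \<delta>) * f z \<partial>N)"
    "pgf_left_deriv_1 p \<le> ennreal (\<kappa> / \<gamma> * (a + integral\<^sup>L N f))"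
proof -
  define w where "w z = f z / max z \<delta>" for z
  define d where "d z n = w z * poisson_perturbation (\<kappa> * max z \<delta>) n" for z n
  define D where "D z s = w z * (exp (- (\<kappa> * max z \<delta>) * (1 - s)) - 1)" for z s
  have w0: "0 \<le> w z" for z using nn \<delta> by (simp add: w_def)
  have pert: "pgf_perturbation 0 (d z) (D z)" for z
    unfolding d_def[abs_def] D_def[abs_def] using w0 \<kappa> \<delta>
    by (intro pgf_perturbation_cmult poisson_perturbation) auto
  have fm: "f \<in> borel_measurable borel"
    using f by (auto simp: measurable_cong_sets[OF N refl])
  have meas: "(\<lambda>z. d z n) \<in> borel_measurable N" for n
    unfolding measurable_cong_sets[OF N refl] d_def w_def poisson_perturbation_def
    using fm by measurable
  have d0: "d z 0 = - (exp_slope \<kappa> (max z \<delta>) * f z)" for z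
    using \<delta> by (simp add: d_def w_def poisson_perturbation_def exp_slope_def field_simps)
  have int: "integrable N (\<lambda>z. d z 0)"
    unfolding d0 using integrable_exp_slope_max[OF N f \<kappa> \<delta>] by simp
  note mix = pgf_perturbation_integral[of N 0 d D, OF pert meas int]
  have "pgf_perturbation 0 (\<lambda>n. inverse \<gamma> * (a / \<delta> * poisson_perturbation (\<kappa> * \<delta>) n + (\<integral>z. d z n \<partial>N)))
    (\<lambda>s. inverse \<gamma> * (a / \<delta> * (exp (- (\<kappa> * \<delta>) * (1 - s)) - 1) + (\<integral>z. D z s \<partial>N)))"
    using a \<gamma> \<delta> \<kappa> by (intro pgf_perturbation_cmult pgf_perturbation_add poisson_perturbation mix) auto
  \<comment> \<open>A jump takes at most its whole rate away from the weight at 0, so the bound on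
    the total rate suffices.\<close>
  moreover have "- 1 \<le> inverse \<gamma> * (a / \<delta> * poisson_perturbation (\<kappa> * \<delta>) 0 + (\<integral>z. d z 0 \<partial>N))"
  proof -
    have "(\<integral>z. exp_slope \<kappa> (max z \<delta>) * f z \<partial>N) \<le> (\<integral>z. inverse \<delta> * f z \<partial>N)"
    proof (rule integral_mono)
      show "integrable N (\<lambda>z. exp_slope \<kappa> (max z \<delta>) * f z)"
        by (rule integrable_exp_slope_max[OF N f \<kappa> \<delta>])
      have "exp_slope \<kappa> (max z \<delta>) \<le> inverse \<delta>" for z
        using exp_slope_bounds(4)[OF \<kappa>, of "max z \<delta>"] \<delta>
        by (smt (verit) le_imp_inverse_le max.cobounded2)
      then show "exp_slope \<kappa> (max z \<delta>) * f z \<le> inverse \<delta> * f z" for z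
        using nn by (rule mult_right_mono)
    qed (use f in simp)
    moreover have "- (a / \<delta>) \<le> a / \<delta> * poisson_perturbation (\<kappa> * \<delta>) 0"
      using a \<delta> mult_left_mono[of "-1" "poisson_perturbation (\<kappa> * \<delta>) 0" "a / \<delta>"]
      by (simp add: poisson_perturbation_def)
    ultimately have "- ((a + integral\<^sup>L N f) / \<delta>) \<le> a / \<delta> * poisson_perturbation (\<kappa> * \<delta>) 0 + (\<integral>z. d z 0 \<partial>N)"
      unfolding d0 by (simp add: divide_inverse mult.commute distrib_left)
    moreover have "(a + integral\<^sup>L N f) / \<delta> \<le> \<gamma>"
      using \<gamma> \<delta> by (simp add: divide_le_eq)
    ultimately show ?thesis using \<gamma> by (simp add: field_simps)
  qed
  ultimately obtain p where p: "\<And>s. s \<in> {0..1} \<Longrightarrow> pgf p s = s ^ 0 +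
      inverse \<gamma> * (a / \<delta> * (exp (- (\<kappa> * \<delta>) * (1 - s)) - 1) + (\<integral>z. D z s \<partial>N))"
    by (rule pgf_perturbation_pmf) blast
  have Deq: "D z s = - (exp_slope (\<kappa> * (1 - s)) (max z \<delta>) * f z)" for z s
    using \<delta> by (simp add: D_def w_def exp_slope_def field_simps)
  have aeq: "a / \<delta> * (exp (- (\<kappa> * \<delta>) * (1 - s)) - 1) = - (exp_slope (\<kappa> * (1 - s)) \<delta> * a)" for s
    using \<delta> by (simp add: exp_slope_def field_simps)
  have cancel: "\<gamma> * (1 - (s ^ 0 + inverse \<gamma> * X)) = - X" for s X :: real
    using \<gamma> by simp
  have eq: "\<gamma> * (1 - pgf p s) = exp_slope (\<kappa> * (1 - s)) \<delta> * a
      + (\<integral>z. exp_slope (\<kappa> * (1 - s)) (max z \<delta>) * f z \<partial>N)" if "s \<in> {0..1}" for s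
    unfolding p[OF that] cancel Deq aeq by simp
  have "pgf_left_deriv_1 p \<le> ennreal (\<kappa> / \<gamma> * (a + integral\<^sup>L N f))"
  proof (rule pgf_left_deriv_1_le)
    fix s :: real assume s: "0 \<le> s" "s < 1"
    then have l: "0 \<le> \<kappa> * (1 - s)" using \<kappa> by simp
    have "exp_slope (\<kappa> * (1 - s)) \<delta> * a \<le> \<kappa> * (1 - s) * a"
      using exp_slope_bounds(2)[OF l \<delta>] a by (rule mult_right_mono)
    moreover have "(\<integral>z. exp_slope (\<kappa> * (1 - s)) (max z \<delta>) * f z \<partial>N) \<le> (\<integral>z. \<kappa> * (1 - s) * f z \<partial>N)"
      using exp_slope_bounds(2)[OF l] \<delta> nn f
      by (intro integral_mono integrable_exp_slope_max[OF N f l \<delta>] mult_right_mono) auto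
    ultimately have "\<gamma> * (1 - pgf p s) \<le> \<kappa> * (1 - s) * (a + integral\<^sup>L N f)"
      using eq[of s] s by (simp add: distrib_left)
    then show "1 - pgf p s \<le> \<kappa> / \<gamma> * (a + integral\<^sup>L N f) * (1 - s)"
      using \<gamma> by (simp add: pos_le_divide_eq mult_ac)
  qed
  then show thesis using eq by (intro that)
qed

subsection \<open>Branching\<close>

text \<open>The derivative in \<open>l\<close> of \<open>exp (- l * z) - 1 + l * z\<close> is
  \<open>z * (1 - exp (- l * z))\<close>. It is nonnegative and increasing in \<open>l\<close>,
  hence largest at the bigger endpoint, where it is at most \<open>z\<close> and at most
  \<open>a * z\<^sup>2\<close>.\<close>

lemma exp_compensator_diff_le:
  fixes z l1 l2 a :: real
  assumes "0 \<le> l1" "l1 \<le> a" "0 \<le> l2" "l2 \<le> a" "0 \<le> z"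
  shows "\<bar>(exp (- l1 * z) - 1 + l1 * z) - (exp (- l2 * z) - 1 + l2 * z)\<bar>
    \<le> max 1 a * min z (z\<^sup>2) * \<bar>l1 - l2\<bar>"
  using assms
proof (induction l1 l2 rule: linorder_wlog)
  case (le l1 l2)
  define t where "t = (l2 - l1) * z"
  have t: "0 \<le> t" using le by (simp add: t_def)
  have e: "exp (- l2 * z) = exp (- l1 * z) * exp (- t)"
    by (simp add: t_def algebra_simps flip: exp_add)
  have e1: "1 - l1 * z \<le> exp (- l1 * z)" "exp (- l1 * z) \<le> 1"
    using exp_ge_add_one_self[of "- l1 * z"] le by auto
  have e2: "1 - l2 * z \<le> exp (- l2 * z)" "exp (- l2 * z) \<le> 1"
    using exp_ge_add_one_self[of "- l2 * z"] le by auto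
  have t2: "1 - t \<le> exp (- t)" "exp (- t) \<le> 1"
    using exp_ge_add_one_self[of "- t"] t by auto
  have lower: "exp (- l1 * z) - exp (- l2 * z) \<le> t"
    using t2 e1 t mult_mono[of "exp (- l1 * z)" 1 "1 - exp (- t)" t] unfolding e
    by (simp add: algebra_simps)
  \<comment> \<open>Convexity: the tangent at \<open>l2\<close> bounds the increment from
    above.\<close>
  have "exp (- l2 * z) * t \<le> exp (- l2 * z) * (exp t - 1)"
    by (intro mult_left_mono) (auto simp: le_diff_eq add.commute)
  also have "\<dots> = exp (- l1 * z) - exp (- l2 * z)"
    unfolding e by (simp add: algebra_simps flip: exp_add)
  finally have up: "t - (exp (- l1 * z) - exp (- l2 * z)) \<le> t * (1 - exp (- l2 * z))"
    by (simp add: algebra_simps)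
  have "z * (1 - exp (- l2 * z)) \<le> max 1 a * min z (z\<^sup>2)"
  proof (cases "z \<le> z\<^sup>2")
    case True
    have "z * (1 - exp (- l2 * z)) \<le> 1 * z"
      using le by (simp add: mult_left_le)
    also have "\<dots> \<le> max 1 a * z" using le by (intro mult_right_mono) auto
    finally show ?thesis using True by simp
  next
    case False
    have "z * (1 - exp (- l2 * z)) \<le> z * (l2 * z)"
      using le e2 by (intro mult_left_mono) auto
    also have "\<dots> = l2 * z\<^sup>2" by (simp add: power2_eq_square)
    also have "\<dots> \<le> max 1 a * z\<^sup>2" using le by (intro mult_right_mono) auto
    finally show ?thesis using False by simp
  qed
  then have "(l2 - l1) * (z * (1 - exp (- l2 * z))) \<le> (l2 - l1) * (max 1 a * min z (z\<^sup>2))"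
    using le by (intro mult_left_mono) auto
  then have "t * (1 - exp (- l2 * z)) \<le> max 1 a * min z (z\<^sup>2) * (l2 - l1)"
    by (simp add: t_def mult_ac)
  moreover have "l2 * z - l1 * z = t" by (simp add: t_def algebra_simps)
  ultimately show ?case
    using lower up le by simp
next
  case (sym l1 l2)
  then show ?case by (simp add: abs_minus_commute)
qed

lemma Rfun_integrand_integrable:
  assumes m: "sets m = sets borel"
    and int: "integrable m (\<lambda>z. indicator {0<..} z * min z (z\<^sup>2))" and l: "0 \<le> l"
  shows "integrable m (\<lambda>z. indicator {0<..} z * (exp (- l * z) - 1 + l * z :: real))"
proof (rule Bochner_Integration.integrable_bound)
  show "integrable m (\<lambda>z. max 1 l * l * (indicator {0<..} z * min z (z\<^sup>2)))"
    using int by (rule integrable_mult_right)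
  show "(\<lambda>z. indicator {0<..} z * (exp (- l * z) - 1 + l * z)) \<in> borel_measurable m"
    unfolding measurable_cong_sets[OF m refl] by measurable
  have "norm (indicator {0<..} z * (exp (- l * z) - 1 + l * z))
      \<le> norm (max 1 l * l * (indicator {0<..} z * min z (z\<^sup>2)))" for z
    using exp_compensator_diff_le[of l l 0 z] l
    by (auto simp: indicator_def abs_mult mult_ac)
  then show "AE z in m. norm (indicator {0<..} z * (exp (- l * z) - 1 + l * z))
      \<le> norm (max 1 l * l * (indicator {0<..} z * min z (z\<^sup>2)))" by simp
qed

lemma Rfun_Lipschitz:
  fixes M :: real
  assumes m: "sets m = sets borel"
    and int: "integrable m (\<lambda>z. indicator {0<..} z * min z (z\<^sup>2))"
    and l: "0 \<le> l1" "l1 \<le> a" "0 \<le> l2" "l2 \<le> a" and c: "0 \<le> c"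
  defines "M \<equiv> \<integral>z. indicator {0<..} z * min z (z\<^sup>2) \<partial>m"
  shows "\<bar>Rfun b c m l1 - Rfun b c m l2\<bar> \<le> (\<bar>b\<bar> + 2 * c * a + max 1 a * M) * \<bar>l1 - l2\<bar>"
proof -
  define \<phi> where "\<phi> l z = indicator {0<..} z * (exp (- l * z) - 1 + l * z :: real)" for l z
  have int\<phi>: "integrable m (\<phi> l)" if "0 \<le> l" for l
    unfolding \<phi>_def[abs_def] using Rfun_integrand_integrable[OF m int that] .
  have R: "Rfun b c m l = b * l + c * l\<^sup>2 + integral\<^sup>L m (\<phi> l)" for l
    by (simp add: Rfun_def set_lebesgue_integral_def \<phi>_def[abs_def])
  have le: "\<bar>\<phi> l1 z - \<phi> l2 z\<bar> \<le> max 1 a * \<bar>l1 - l2\<bar> * (indicator {0<..} z * min z (z\<^sup>2))" for z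
    using exp_compensator_diff_le[OF l, of z] by (auto simp: \<phi>_def indicator_def mult_ac)
  have "\<bar>integral\<^sup>L m (\<phi> l1) - integral\<^sup>L m (\<phi> l2)\<bar> = \<bar>\<integral>z. \<phi> l1 z - \<phi> l2 z \<partial>m\<bar>"
    using int\<phi> l by simp
  also have "\<dots> \<le> (\<integral>z. \<bar>\<phi> l1 z - \<phi> l2 z\<bar> \<partial>m)"
    using integral_abs_bound .
  also have "\<dots> \<le> (\<integral>z. max 1 a * \<bar>l1 - l2\<bar> * (indicator {0<..} z * min z (z\<^sup>2)) \<partial>m)"
    using int\<phi> int l le by (intro integral_mono) auto
  finally have 1: "\<bar>integral\<^sup>L m (\<phi> l1) - integral\<^sup>L m (\<phi> l2)\<bar> \<le> max 1 a * M * \<bar>l1 - l2\<bar>"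
    by (simp add: M_def mult_ac)
  have "\<bar>c * l1\<^sup>2 - c * l2\<^sup>2\<bar> = c * (l1 + l2) * \<bar>l1 - l2\<bar>"
    using c l by (simp add: power2_eq_square abs_mult square_diff_square_factored flip: right_diff_distrib)
  also have "\<dots> \<le> c * (2 * a) * \<bar>l1 - l2\<bar>"
    using c l by (intro mult_right_mono mult_left_mono) auto
  finally have 2: "\<bar>c * l1\<^sup>2 - c * l2\<^sup>2\<bar> \<le> 2 * c * a * \<bar>l1 - l2\<bar>" by simp
  have 3: "\<bar>b * l1 - b * l2\<bar> = \<bar>b\<bar> * \<bar>l1 - l2\<bar>"
    by (simp add: abs_mult flip: right_diff_distrib)
  show ?thesis
    using 1 2 3 unfolding R distrib_right by linarith
qed

text \<open>A negative drift \<open>b\<close> cannot be realised by extra deaths; it is produced by extra binary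
  splittings, which costs the error term of order \<open>1/\<kappa>\<close>.\<close>

lemma branching_pmf:
  assumes m: "sets m = sets borel"
    and int: "integrable m (\<lambda>z. indicator {0<..} z * min z (z\<^sup>2))"
    and c: "0 \<le> c" and \<kappa>: "1 \<le> \<kappa>" and C: "0 < C"
    and C_ge: "2 * c + \<bar>b\<bar> + (\<integral>z. indicator {0<..} z * min z (z\<^sup>2) \<partial>m) \<le> C"
  obtains p where "\<And>l. 0 \<le> l \<Longrightarrow> l \<le> \<kappa> \<Longrightarrow>
    \<kappa> * (C * \<kappa>) * (pgf p (1 - l / \<kappa>) - (1 - l / \<kappa>)) = Rfun b c m l + max 0 (- b) * l\<^sup>2 / \<kappa>"
proof -
  \<comment> \<open>Replacing \<open>z\<close> by \<open>max 0 z\<close> makes the perturbation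
    legitimate for every real \<open>z\<close>; for \<open>z \<le> 0\<close> the mean is 0 and the
    perturbation vanishes.\<close>
  define d where "d z = compensated_poisson_perturbation (\<kappa> * max 0 z)" for z
  define D where "D z s = exp (- (\<kappa> * max 0 z) * (1 - s)) - 1 + (\<kappa> * max 0 z) * (1 - s)" for z s
  have pert: "pgf_perturbation 1 (d z) (D z)" for z
    unfolding d_def D_def[abs_def] using \<kappa> by (intro compensated_poisson_perturbation) auto
  have meas: "(\<lambda>z. d z n) \<in> borel_measurable m" for n
    unfolding measurable_cong_sets[OF m refl] d_def compensated_poisson_perturbation_def
      poisson_perturbation_def by measurable
  have d1: "d z 1 = - (\<kappa> * max 0 z * (1 - exp (- (\<kappa> * max 0 z))))" for z
    by (simp add: d_def compensated_poisson_perturbation_def poisson_perturbation_def algebra_simps)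
  \<comment> \<open>The two regimes naturally give \<open>\<kappa> * z\<close> and
    \<open>\<kappa>\<^sup>2 * z\<^sup>2\<close>; as \<open>1 \<le> \<kappa>\<close>, the factor
    \<open>\<kappa>\<^sup>2\<close> serves both.\<close>
  have bound: "\<bar>d z 1\<bar> \<le> \<kappa>\<^sup>2 * (indicator {0<..} z * min z (z\<^sup>2))" for z
  proof (cases "0 < z")
    case True
    define u where "u = \<kappa> * z"
    have u: "0 \<le> u" using True \<kappa> by (simp add: u_def)
    have e: "0 \<le> 1 - exp (- u)" "1 - exp (- u) \<le> 1" "1 - exp (- u) \<le> u"
      using u exp_ge_add_one_self[of "- u"] by auto
    have "\<bar>d z 1\<bar> = u * (1 - exp (- u))"
      using True u e unfolding d1 by (simp add: u_def[symmetric] abs_mult)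
    moreover have "u * (1 - exp (- u)) \<le> u" "u * (1 - exp (- u)) \<le> u * u"
      using u e by (auto intro: mult_left_mono simp: mult_left_le)
    moreover have "u \<le> \<kappa>\<^sup>2 * z"
      using \<kappa> True by (auto simp: u_def power2_eq_square)
    moreover have "u * u = \<kappa>\<^sup>2 * z\<^sup>2" by (simp add: u_def power2_eq_square)
    ultimately have "\<bar>d z 1\<bar> \<le> min (\<kappa>\<^sup>2 * z) (\<kappa>\<^sup>2 * z\<^sup>2)" by simp
    then show ?thesis using True by (simp add: min_mult_distrib_left)
  qed (unfold d1, simp add: max_def)
  have int1: "integrable m (\<lambda>z. d z 1)"
  proof (rule Bochner_Integration.integrable_bound[OF _ meas])
    show "integrable m (\<lambda>z. \<kappa>\<^sup>2 * (indicator {0<..} z * min z (z\<^sup>2)))"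
      using int by (rule integrable_mult_right)
    show "AE z in m. norm (d z 1) \<le> norm (\<kappa>\<^sup>2 * (indicator {0<..} z * min z (z\<^sup>2)))"
      using bound by (intro AE_I2) (smt (verit) real_norm_def)
  qed
  note mix = pgf_perturbation_integral[of m 1 d D, OF pert meas int1]
  \<comment> \<open>Deaths carry the positive part of \<open>b\<close>, binary splitting the
    negative part, critical branching carries \<open>c\<close>, and the mixture carries the jumps.
    The powers of \<open>\<kappa>\<close> undo \<open>1 - s = l / \<kappa>\<close>, and the
    prefactor undoes the scaling \<open>\<kappa> * (C * \<kappa>)\<close>.\<close>
  define e where "e n = inverse (\<kappa> * (C * \<kappa>)) * (((max 0 b * \<kappa> * (if n = 0 then 1 else if n = 1 then - 1 else 0)
      + max 0 (- b) * \<kappa> * (if n = 2 then 1 else if n = 1 then - 1 else 0))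
      + c * \<kappa>\<^sup>2 * (if n = 1 then - 2 else if n \<le> 2 then 1 else 0)) + (\<integral>z. d z n \<partial>m))" for n :: nat
  define E where "E s = inverse (\<kappa> * (C * \<kappa>)) * (((max 0 b * \<kappa> * (1 - s)
      + max 0 (- b) * \<kappa> * (s\<^sup>2 - s)) + c * \<kappa>\<^sup>2 * (1 - s)\<^sup>2) + (\<integral>z. D z s \<partial>m))" for s
  have "pgf_perturbation 1 e E"
    unfolding e_def[abs_def] E_def[abs_def] using \<kappa> c C
    by (intro pgf_perturbation_cmult pgf_perturbation_add linear_perturbation
        binary_branching_perturbation quadratic_perturbation mix) auto
  moreover have "- 1 \<le> e 1"
  \<comment> \<open>After bounding \<open>\<bar>b\<bar> * \<kappa>\<close> by
    \<open>\<kappa>\<^sup>2 * \<bar>b\<bar>\<close>, all negative contributions at 1 add up to at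
    most \<open>\<kappa>\<^sup>2 * C\<close>, exactly what the prefactor normalises to 1.\<close>
  proof -
    have "\<bar>\<integral>z. d z 1 \<partial>m\<bar> \<le> (\<integral>z. \<bar>d z 1\<bar> \<partial>m)"
      using integral_abs_bound .
    also have "\<dots> \<le> (\<integral>z. \<kappa>\<^sup>2 * (indicator {0<..} z * min z (z\<^sup>2)) \<partial>m)"
      using int1 int bound by (intro integral_mono) auto
    also have "\<dots> = \<kappa>\<^sup>2 * (\<integral>z. indicator {0<..} z * min z (z\<^sup>2) \<partial>m)"
      by simp
    finally have "- (\<kappa>\<^sup>2 * (\<integral>z. indicator {0<..} z * min z (z\<^sup>2) \<partial>m)) \<le> (\<integral>z. d z 1 \<partial>m)"
      by linarith
    moreover have "\<bar>b\<bar> * \<kappa> \<le> \<kappa>\<^sup>2 * \<bar>b\<bar>"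
      using \<kappa> mult_right_mono[of 1 \<kappa> "\<kappa> * \<bar>b\<bar>"] by (simp add: power2_eq_square mult_ac)
    moreover have "\<bar>b\<bar> * \<kappa> = max 0 b * \<kappa> + max 0 (- b) * \<kappa>"
      by (simp add: max_def)
    moreover have "\<kappa>\<^sup>2 * (2 * c + \<bar>b\<bar> + (\<integral>z. indicator {0<..} z * min z (z\<^sup>2) \<partial>m)) \<le> \<kappa>\<^sup>2 * C"
      using C_ge by (intro mult_left_mono) auto
    ultimately have "- (\<kappa>\<^sup>2 * C) \<le> ((max 0 b * \<kappa> * - 1 + max 0 (- b) * \<kappa> * - 1) + c * \<kappa>\<^sup>2 * - 2) + (\<integral>z. d z 1 \<partial>m)"
      by (simp add: distrib_left mult_ac)
    then have "inverse (\<kappa>\<^sup>2 * C) * - (\<kappa>\<^sup>2 * C) \<le> inverse (\<kappa>\<^sup>2 * C) *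
        (((max 0 b * \<kappa> * - 1 + max 0 (- b) * \<kappa> * - 1) + c * \<kappa>\<^sup>2 * - 2) + (\<integral>z. d z 1 \<partial>m))"
      using C by (intro mult_left_mono) auto
    moreover have "inverse (\<kappa>\<^sup>2 * C) * - (\<kappa>\<^sup>2 * C) = - 1"
      using C \<kappa> by (subst mult_minus_right, subst left_inverse) auto
    moreover have "e 1 = inverse (\<kappa>\<^sup>2 * C) *
        (((max 0 b * \<kappa> * - 1 + max 0 (- b) * \<kappa> * - 1) + c * \<kappa>\<^sup>2 * - 2) + (\<integral>z. d z 1 \<partial>m))"
      unfolding e_def by (simp add: power2_eq_square mult_ac)
    ultimately show ?thesis by linarith
  qed
  ultimately obtain p where p: "\<And>s. s \<in> {0..1} \<Longrightarrow> pgf p s = s ^ 1 + E s"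
    by (rule pgf_perturbation_pmf) blast
  show thesis
  proof (rule that[of p])
    fix l assume l: "0 \<le> l" "l \<le> \<kappa>"
    have D: "(\<integral>z. D z (1 - l / \<kappa>) \<partial>m) = (LINT z:{0<..}|m. exp (- l * z) - 1 + l * z)"
      unfolding set_lebesgue_integral_def using \<kappa>
      by (intro Bochner_Integration.integral_cong refl) (auto simp: D_def indicator_def max_def)
    have "pgf p (1 - l / \<kappa>) - (1 - l / \<kappa>) = E (1 - l / \<kappa>)"
      using p[of "1 - l / \<kappa>"] l \<kappa> by simp
    moreover have "\<kappa> * (C * \<kappa>) * (inverse (\<kappa> * (C * \<kappa>)) * X) = X" for X
      using \<kappa> C by (subst mult.assoc[symmetric], subst right_inverse) auto
    ultimately have "\<kappa> * (C * \<kappa>) * (pgf p (1 - l / \<kappa>) - (1 - l / \<kappa>)) =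
        max 0 b * \<kappa> * (l / \<kappa>) + max 0 (- b) * \<kappa> * ((1 - l / \<kappa>)\<^sup>2 - (1 - l / \<kappa>)) + c * \<kappa>\<^sup>2 * (l / \<kappa>)\<^sup>2
        + (LINT z:{0<..}|m. exp (- l * z) - 1 + l * z)"
      by (simp only: E_def D diff_diff_eq2 add_diff_cancel_left')
    also have "\<dots> = Rfun b c m l + max 0 (- b) * l\<^sup>2 / \<kappa>"
      using \<kappa> by (auto simp: Rfun_def max_def field_simps power2_eq_square)
    finally show "\<kappa> * (C * \<kappa>) * (pgf p (1 - l / \<kappa>) - (1 - l / \<kappa>)) = Rfun b c m l + max 0 (- b) * l\<^sup>2 / \<kappa>" .
  qed
qed

subsection \<open>The approximation\<close>

text \<open>Converts the extended-real bounds of (S1) and (S2), which encode finiteness of the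
  integrals, into integrability and real inequalities.\<close>

lemma integrable_of_nn_integral_bound:
  fixes g :: "'a \<Rightarrow> real"
  assumes g: "g \<in> borel_measurable N" and nn: "\<And>z. 0 \<le> g z" and a: "0 \<le> a" and B: "0 \<le> B"
    and le: "ennreal a + (\<integral>\<^sup>+ z. ennreal (g z) \<partial>N) \<le> ennreal B"
  shows "integrable N g" "a + integral\<^sup>L N g \<le> B"
proof -
  have "(\<integral>\<^sup>+ z. ennreal (g z) \<partial>N) \<le> ennreal B"
    by (rule order.trans[OF _ le]) simp
  then show int: "integrable N g"
    using g nn by (intro integrableI_nonneg) (auto simp: le_less_trans)
  have "ennreal (a + integral\<^sup>L N g) = ennreal a + (\<integral>\<^sup>+ z. ennreal (g z) \<partial>N)"
    using nn_integral_eq_integral[OF int] nn a by simp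
  with le B show "a + integral\<^sup>L N g \<le> B" by (metis ennreal_le_iff)
qed

text \<open>If \<open>r\<close> stayed above \<open>e\<close> on the positive axis, its reciprocal
  would have integral at most \<open>inverse e\<close> over the unit interval.\<close>

lemma ex_small_value_of_infinite_reciprocal_integral:
  fixes r :: "real \<Rightarrow> real"
  assumes inf: "(\<integral>\<^sup>+ z\<in>{0<..1}. inverse (ennreal (r z)) \<partial>lborel) = \<infinity>" and e: "0 < e"
  obtains d where "0 < d" "r d < e"
proof (rule ccontr)
  assume "\<not> thesis"
  with that have r: "e \<le> r z" if "0 < z" for z using that by (meson not_less)
  have "(\<integral>\<^sup>+ z\<in>{0<..1}. inverse (ennreal (r z)) \<partial>lborel)
      \<le> (\<integral>\<^sup>+ z. ennreal (inverse e) * indicator {0<..1::real} z \<partial>lborel)"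
  proof (rule nn_integral_mono)
    fix z :: real
    show "inverse (ennreal (r z)) * indicator {0<..1} z \<le> ennreal (inverse e) * indicator {0<..1} z"
    proof (cases "0 < z")
      case True
      then have "inverse (ennreal (r z)) = ennreal (inverse (r z))"
        using r[of z] e by (intro inverse_ennreal) auto
      moreover have "inverse (r z) \<le> inverse e"
        using r[of z] e True by (intro le_imp_inverse_le) auto
      ultimately show ?thesis by (auto simp: indicator_def intro: ennreal_leI)
    qed simp
  qed
  also have "\<dots> = ennreal (inverse e)"
    by (simp add: nn_integral_cmult_indicator)
  finally show False using inf by (simp add: top_unique)
qed

lemma Ffun_eq:
  fixes q :: "real \<Rightarrow> real \<Rightarrow> real"
  shows "Ffun \<beta> q \<pi> l x = - (l * \<beta> x + (\<integral>z. exp_slope l z * (if 0 < z then q x z * z else 0) \<partial>\<pi>))"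
proof -
  have "(LINT z:{0<..}|\<pi>. (exp (- l * z) - 1) * q x z)
      = (\<integral>z. - (exp_slope l z * (if 0 < z then q x z * z else 0)) \<partial>\<pi>)"
    unfolding set_lebesgue_integral_def
    by (intro Bochner_Integration.integral_cong refl)
      (auto simp: exp_slope_def indicator_def field_simps)
  then show ?thesis by (simp add: Ffun_def)
qed

text \<open>Because the slope is at most \<open>l\<close>, the dependence of \<open>F\<close> on the
  state is controlled by the left-hand side of (S2).\<close>

lemma exp_slope_integral_Lipschitz:
  assumes N: "sets N = sets borel" and f: "integrable N f" and g: "integrable N g" and l: "0 \<le> l"
    and f0: "\<And>z. z \<le> 0 \<Longrightarrow> f z = 0" and g0: "\<And>z. z \<le> 0 \<Longrightarrow> g z = 0"
  shows "\<bar>(l * a + (\<integral>z. exp_slope l z * f z \<partial>N)) - (l * b + (\<integral>z. exp_slope l z * g z \<partial>N))\<bar>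
    \<le> l * (\<bar>a - b\<bar> + (\<integral>z. \<bar>f z - g z\<bar> \<partial>N))"
proof -
  note int = integrable_exp_slope[OF N f l f0] integrable_exp_slope[OF N g l g0]
  have le: "\<bar>exp_slope l z * f z - exp_slope l z * g z\<bar> \<le> l * \<bar>f z - g z\<bar>" for z
    using exp_slope_bounds(1,2)[OF l, of z] f0[of z] g0[of z]
    by (cases "0 < z") (auto simp: abs_mult intro!: mult_right_mono simp flip: right_diff_distrib)
  have "\<bar>(\<integral>z. exp_slope l z * f z \<partial>N) - (\<integral>z. exp_slope l z * g z \<partial>N)\<bar>
      = \<bar>\<integral>z. exp_slope l z * f z - exp_slope l z * g z \<partial>N\<bar>"
    using int by simp
  also have "\<dots> \<le> (\<integral>z. \<bar>exp_slope l z * f z - exp_slope l z * g z\<bar> \<partial>N)"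
    using integral_abs_bound .
  also have "\<dots> \<le> (\<integral>z. l * \<bar>f z - g z\<bar> \<partial>N)"
    using int f g le by (intro integral_mono) auto
  finally have "\<bar>(\<integral>z. exp_slope l z * f z \<partial>N) - (\<integral>z. exp_slope l z * g z \<partial>N)\<bar>
      \<le> l * (\<integral>z. \<bar>f z - g z\<bar> \<partial>N)" by simp
  moreover have "\<bar>l * a - l * b\<bar> = l * \<bar>a - b\<bar>"
    using l by (simp add: abs_mult flip: right_diff_distrib)
  ultimately show ?thesis unfolding distrib_left by linarith
qed

lemma pgf_left_deriv_1_return_0 [simp]: "pgf_left_deriv_1 (return_pmf 0) = 0"
proof -
  have "ennreal (real n * pmf (return_pmf 0) n) = 0" for n :: nat
    by (cases n) auto
  then have "(\<lambda>n. ennreal (real n * pmf (return_pmf 0) n)) = (\<lambda>_. 0)" by blast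
  then show ?thesis by (simp only: pgf_left_deriv_1_def suminf_zero)
qed

theorem theorem2p1:
  fixes b c :: real and m \<pi> :: "real measure"
    and \<beta> :: "real \<Rightarrow> real" and q :: "real \<Rightarrow> real \<Rightarrow> real"
  assumes c_nonneg: "c \<ge> 0"
    and m_borel: "sets m = sets borel" and m_supp: "emeasure m {..0} = 0"
    and m_int: "(\<integral>\<^sup>+ z. ennreal (min z (z^2)) \<partial>m) < \<infinity>"
    and pi_borel: "sets \<pi> = sets borel" and pi_supp: "emeasure \<pi> {..0} = 0"
    and pi_sfin: "sigma_finite_measure \<pi>"
    and beta_meas: "\<beta> \<in> borel_measurable (restrict_space borel {0..})"
    and beta_nonneg: "\<forall>x\<ge>0. \<beta> x \<ge> 0"
    and q_meas: "(\<lambda>(x, z). q x z) \<in> borel_measurable (restrict_space borel ({0..} \<times> {0<..}))"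
    and q_nonneg: "\<forall>x\<ge>0. \<forall>z>0. q x z \<ge> 0"
    and S1: "\<exists>K\<ge>0. \<forall>x\<ge>0. ennreal \<bar>\<beta> x\<bar> + (\<integral>\<^sup>+ z\<in>{0<..}. ennreal (q x z * z) \<partial>\<pi>)
                 \<le> ennreal (K * (1 + x))"
    and S2: "\<exists>r :: real \<Rightarrow> real.
              (\<forall>z\<ge>0. r z \<ge> 0) \<and> mono_on {0..} r \<and> concave_on {0..} r \<and>
              (\<forall>\<epsilon>>0. (\<integral>\<^sup>+ z\<in>{0<..\<epsilon>}. inverse (ennreal (r z)) \<partial>lborel) = \<infinity>) \<and>
              (\<forall>x\<ge>0. \<forall>y\<ge>0. ennreal \<bar>\<beta> x - \<beta> y\<bar>
                   + (\<integral>\<^sup>+ z\<in>{0<..}. ennreal (\<bar>q x z - q y z\<bar> * z) \<partial>\<pi>)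
                 \<le> ennreal (r \<bar>x - y\<bar>))"
  shows "\<exists>(\<gamma> :: nat \<Rightarrow> real) (g :: nat \<Rightarrow> nat pmf) (h :: nat \<Rightarrow> nat \<Rightarrow> nat pmf).
           (\<forall>k\<ge>1. 0 < \<gamma> k) \<and> (\<forall>k\<ge>1. \<gamma> k \<le> \<gamma> (Suc k)) \<and> filterlim \<gamma> at_top sequentially \<and>
           \<comment> \<open>(A)\<close>
           (\<forall>a>0. \<exists>L. \<forall>k\<ge>1. \<forall>l1 l2. l1 \<in> {0..min a (real k)} \<longrightarrow> l2 \<in> {0..min a (real k)} \<longrightarrow>
               \<bar>Rk \<gamma> g k l1 - Rk \<gamma> g k l2\<bar> \<le> L * \<bar>l1 - l2\<bar>) \<and>
           (\<forall>l\<ge>0. (\<lambda>k. Rk \<gamma> g k l) \<longlonglongrightarrow> Rfun b c m l) \<and>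
           \<comment> \<open>(B)\<close>
           (\<forall>a1>0. \<forall>a2>0. uniform_limit ({0..a1} \<times> {0..a2})
               (\<lambda>k (l, x). Fk \<gamma> h k l x) (\<lambda>(l, x). Ffun \<beta> q \<pi> l x) sequentially) \<and>
           \<comment> \<open>(C)\<close>
           (\<exists>K1>0. \<forall>x\<ge>0. \<forall>k\<ge>1.
               ennreal (\<gamma> k / real k) * pgf_left_deriv_1 (h k (nat \<lfloor>real k * x\<rfloor>))
                 \<le> ennreal (K1 * (1 + x)))"
proof -
  obtain K where K: "0 \<le> K" and K_le: "\<And>x. 0 \<le> x \<Longrightarrow> ennreal \<bar>\<beta> x\<bar>
      + (\<integral>\<^sup>+ z\<in>{0<..}. ennreal (q x z * z) \<partial>\<pi>) \<le> ennreal (K * (1 + x))"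
    using S1 by blast
  obtain r where r0: "\<And>z. 0 \<le> z \<Longrightarrow> 0 \<le> r z" and r_mono: "mono_on {0..} r"
    and r_inf: "\<And>\<epsilon>. 0 < \<epsilon> \<Longrightarrow> (\<integral>\<^sup>+ z\<in>{0<..\<epsilon>}. inverse (ennreal (r z)) \<partial>lborel) = \<infinity>"
    and r_le: "\<And>x y. 0 \<le> x \<Longrightarrow> 0 \<le> y \<Longrightarrow> ennreal \<bar>\<beta> x - \<beta> y\<bar>
      + (\<integral>\<^sup>+ z\<in>{0<..}. ennreal (\<bar>q x z - q y z\<bar> * z) \<partial>\<pi>) \<le> ennreal (r \<bar>x - y\<bar>)"
    using S2 by blast

  \<comment> \<open>Constants and offspring laws\<close>
  have m_int': "integrable m (\<lambda>z. indicator {0<..} z * min z (z\<^sup>2))"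
  proof (rule integrableI_nonneg)
    show "(\<lambda>z. indicator {0<..} z * min z (z\<^sup>2)) \<in> borel_measurable m"
      unfolding measurable_cong_sets[OF m_borel refl] by measurable
    have "(\<integral>\<^sup>+ z. ennreal (indicator {0<..} z * min z (z\<^sup>2)) \<partial>m) = (\<integral>\<^sup>+ z. ennreal (min z (z\<^sup>2)) \<partial>m)"
    proof (rule nn_integral_cong)
      fix z :: real
      \<comment> \<open>For \<open>z \<le> 0\<close> the minimum is nonpositive and
        \<open>ennreal\<close> truncates it to 0, so the indicator changes nothing.\<close>
      show "ennreal (indicator {0<..} z * min z (z\<^sup>2)) = ennreal (min z (z\<^sup>2))"
        by (cases "0 < z") (simp_all add: ennreal_eq_0_iff min_le_iff_disj)
    qed
    then show "(\<integral>\<^sup>+ z. ennreal (indicator {0<..} z * min z (z\<^sup>2)) \<partial>m) < \<infinity>"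
      using m_int by simp
  qed (auto simp: indicator_def)
  define M where "M = (\<integral>z. indicator {0<..} z * min z (z\<^sup>2) \<partial>m)"
  have M: "0 \<le> M"
    unfolding M_def by (intro integral_nonneg_AE AE_I2) (auto simp: indicator_def)
  \<comment> \<open>The sum dominates what \<open>branching_pmf\<close> demands; the summand 1 makes
    \<open>C\<close> strictly positive even if all other terms vanish.\<close>
  define C where "C = 1 + 2 * c + \<bar>b\<bar> + M"
  have C: "0 < C" "2 * c + \<bar>b\<bar> + M \<le> C" using c_nonneg M by (auto simp: C_def)
  define \<gamma> where "\<gamma> k = C * real k" for k :: nat
  \<comment> \<open>The choice balances two needs: \<open>\<delta> k\<close> tends to 0, while the
    admissible total mean \<open>\<gamma> k * \<delta> k = C * sqrt (real k)\<close> tends to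
    infinity.\<close>
  define \<delta> where "\<delta> k = inverse (sqrt (real k))" for k :: nat

  have "\<exists>p. 1 \<le> k \<longrightarrow> (\<forall>l. 0 \<le> l \<longrightarrow> l \<le> real k \<longrightarrow>
      real k * \<gamma> k * (pgf p (1 - l / real k) - (1 - l / real k)) = Rfun b c m l + max 0 (- b) * l\<^sup>2 / real k)"
    for k :: nat
  proof (cases "1 \<le> k")
    case True
    then have "1 \<le> real k" by simp
    from branching_pmf[OF m_borel m_int' c_nonneg this C(1) C(2)[unfolded M_def]] obtain p where
      "\<And>l. 0 \<le> l \<Longrightarrow> l \<le> real k \<Longrightarrow>
        real k * \<gamma> k * (pgf p (1 - l / real k) - (1 - l / real k)) = Rfun b c m l + max 0 (- b) * l\<^sup>2 / real k"
      unfolding \<gamma>_def by blast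
    then show ?thesis by blast
  qed simp
  then obtain g where "\<And>k l. 1 \<le> k \<Longrightarrow> 0 \<le> l \<Longrightarrow> l \<le> real k \<Longrightarrow>
      real k * \<gamma> k * (pgf (g k) (1 - l / real k) - (1 - l / real k)) = Rfun b c m l + max 0 (- b) * l\<^sup>2 / real k"
    by metis
  then have Rk: "Rk \<gamma> g k l = Rfun b c m l + max 0 (- b) * l\<^sup>2 / real k"
    if "1 \<le> k" "0 \<le> l" "l \<le> real k" for k l
    using that by (simp add: Rk_def)

  \<comment> \<open>Immigration laws\<close>
  define f where "f x z = (if 0 < z then q x z * z else 0)" for x z :: real
  have f0: "f x z = 0" if "z \<le> 0" for x z using that by (simp add: f_def)
  have f_nn: "0 \<le> f x z" if "0 \<le> x" for x z
    using q_nonneg that by (simp add: f_def)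
  have f_meas: "f x \<in> borel_measurable \<pi>" if x: "0 \<le> x" for x
  proof -
    have "Pair x \<in> measurable (restrict_space borel {0<..}) (restrict_space borel ({0..} \<times> {0<..}))"
      using x by (intro measurable_restrict_space3 borel_measurable_continuous_onI continuous_intros) auto
    then have "q x \<in> borel_measurable (restrict_space borel {0<..})"
      using measurable_compose[OF _ q_meas, of "Pair x"] by simp
    then have "(\<lambda>z. q x z * z) \<in> borel_measurable (restrict_space borel {0<..})"
      by (rule borel_measurable_times) (auto intro: measurable_restrict_space1)
    then have "(\<lambda>z. (q x z * z) * indicator {0<..} z) \<in> borel_measurable borel"
      by (subst (asm) borel_measurable_restrict_space_iff) (auto simp: mult_ac)
    moreover have "(\<lambda>z. (q x z * z) * indicator {0<..} z) = f x"
      by (auto simp: f_def indicator_def)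
    ultimately show ?thesis by (simp add: measurable_cong_sets[OF pi_borel refl])
  qed
  have f_nni: "(\<integral>\<^sup>+ z. ennreal (f x z) \<partial>\<pi>) = (\<integral>\<^sup>+ z\<in>{0<..}. ennreal (q x z * z) \<partial>\<pi>)" for x
    by (intro nn_integral_cong) (simp add: f_def indicator_def)
  have f: "integrable \<pi> (f x)" "\<beta> x + integral\<^sup>L \<pi> (f x) \<le> K * (1 + x)" if x: "0 \<le> x" for x
    using integrable_of_nn_integral_bound[of "f x" \<pi> "\<beta> x" "K * (1 + x)"]
      f_meas[OF x] f_nn[OF x] beta_nonneg x K K_le[OF x] by (auto simp: f_nni)
  have f_diff: "\<bar>\<beta> x - \<beta> y\<bar> + (\<integral>z. \<bar>f x z - f y z\<bar> \<partial>\<pi>) \<le> r \<bar>x - y\<bar>"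
    if x: "0 \<le> x" and y: "0 \<le> y" for x y
  proof (rule integrable_of_nn_integral_bound(2))
    have "(\<integral>\<^sup>+ z. ennreal \<bar>f x z - f y z\<bar> \<partial>\<pi>) = (\<integral>\<^sup>+ z\<in>{0<..}. ennreal (\<bar>q x z - q y z\<bar> * z) \<partial>\<pi>)"
      by (intro nn_integral_cong) (simp add: f_def indicator_def abs_mult flip: left_diff_distrib)
    then show "ennreal \<bar>\<beta> x - \<beta> y\<bar> + (\<integral>\<^sup>+ z. ennreal \<bar>f x z - f y z\<bar> \<partial>\<pi>) \<le> ennreal (r \<bar>x - y\<bar>)"
      using r_le[OF x y] by simp
    show "(\<lambda>z. \<bar>f x z - f y z\<bar>) \<in> borel_measurable \<pi>"
      using f_meas[OF x] f_meas[OF y] by measurable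
  qed (use r0 in auto)

  define a where "a y = \<beta> y + C" for y
  have a0: "0 \<le> a y" if "0 \<le> y" for y using that beta_nonneg C by (simp add: a_def add_nonneg_pos less_imp_le)
  have a_le: "a y + integral\<^sup>L \<pi> (f y) \<le> K * (1 + y) + C" if "0 \<le> y" for y
    using f(2)[OF that] by (simp add: a_def)
  \<comment> \<open>The rate condition is stated with the linear growth bound instead of the actual
    total mean, so that on bounded sets of states it follows from one inequality. The mean estimate
    is outside that condition because (C) concerns all states and all \<open>k \<ge> 1\<close>; the
    fallback \<open>return_pmf 0\<close> satisfies it with mean 0.\<close>
  define P where "P k i p \<longleftrightarrow> (1 \<le> k \<longrightarrow> K * (1 + real i / real k) + C \<le> \<gamma> k * \<delta> k \<longrightarrow>
        (\<forall>s\<in>{0..1}. \<gamma> k * (1 - pgf p s) = exp_slope (real k * (1 - s)) (\<delta> k) * a (real i / real k)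
          + (\<integral>z. exp_slope (real k * (1 - s)) (max z (\<delta> k)) * f (real i / real k) z \<partial>\<pi>))) \<and>
      (1 \<le> k \<longrightarrow> pgf_left_deriv_1 p
        \<le> ennreal (real k / \<gamma> k * (K * (1 + real i / real k) + C)))" for k i :: nat and p
  have "\<exists>p. P k i p" for k i
  proof (cases "1 \<le> k \<and> K * (1 + real i / real k) + C \<le> \<gamma> k * \<delta> k")
    case True
    define y where "y = real i / real k"
    have y: "0 \<le> y" by (simp add: y_def)
    have k: "0 < \<gamma> k" "0 < \<delta> k" using True C by (auto simp: \<gamma>_def \<delta>_def)
    have "a y + integral\<^sup>L \<pi> (f y) \<le> \<gamma> k * \<delta> k"
      using a_le[OF y] True by (simp add: y_def)
    then obtain p where p: "\<And>s. s \<in> {0..1} \<Longrightarrow> \<gamma> k * (1 - pgf p s) = exp_slope (real k * (1 - s)) (\<delta> k) * a y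
          + (\<integral>z. exp_slope (real k * (1 - s)) (max z (\<delta> k)) * f y z \<partial>\<pi>)"
      "pgf_left_deriv_1 p \<le> ennreal (real k / \<gamma> k * (a y + integral\<^sup>L \<pi> (f y)))"
      using immigration_pmf[OF pi_borel f(1)[OF y] of_nat_0_le_iff k(2) f_nn[OF y] a0[OF y] k(1), of k] by blast
    have "real k / \<gamma> k * (a y + integral\<^sup>L \<pi> (f y)) \<le> real k / \<gamma> k * (K * (1 + y) + C)"
      using a_le[OF y] k by (intro mult_left_mono) auto
    then have "pgf_left_deriv_1 p \<le> ennreal (real k / \<gamma> k * (K * (1 + y) + C))"
      using p(2) by (meson ennreal_leI order.trans)
    with p(1) show ?thesis unfolding P_def y_def by blast
  next
    case False
    then show ?thesis by (intro exI[of _ "return_pmf 0"]) (auto simp: P_def)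
  qed
  then obtain h where "\<And>k i. P k i (h k i)"
    by metis
  then have h: "\<And>k i s. 1 \<le> k \<Longrightarrow> K * (1 + real i / real k) + C \<le> \<gamma> k * \<delta> k \<Longrightarrow> s \<in> {0..1} \<Longrightarrow>
        \<gamma> k * (1 - pgf (h k i) s) = exp_slope (real k * (1 - s)) (\<delta> k) * a (real i / real k)
          + (\<integral>z. exp_slope (real k * (1 - s)) (max z (\<delta> k)) * f (real i / real k) z \<partial>\<pi>)"
      and h_mean: "\<And>k i. 1 \<le> k \<Longrightarrow> pgf_left_deriv_1 (h k i)
        \<le> ennreal (real k / \<gamma> k * (K * (1 + real i / real k) + C))"
    unfolding P_def by blast+

  have grid: "real (nat \<lfloor>real k * x\<rfloor>) / real k \<le> x" "x - real (nat \<lfloor>real k * x\<rfloor>) / real k \<le> 1 / real k"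
    if "1 \<le> k" "0 \<le> x" for k x
  proof -
    define n where "n = real (nat \<lfloor>real k * x\<rfloor>)"
    have n: "n \<le> real k * x" "real k * x \<le> n + 1"
      using that floor_correct[of "real k * x"] by (auto simp: n_def)
    have k: "0 < real k" using that by simp
    show "n / real k \<le> x" using n(1) k by (simp add: pos_divide_le_eq mult.commute)
    have "x \<le> (n + 1) / real k" using n(2) k by (simp add: pos_le_divide_eq mult.commute)
    then show "x - n / real k \<le> 1 / real k" by (simp add: add_divide_distrib)
  qed

  \<comment> \<open>Condition (A)\<close>
  have Lipschitz: "\<exists>L. \<forall>k\<ge>1. \<forall>l1 l2. l1 \<in> {0..min a (real k)} \<longrightarrow> l2 \<in> {0..min a (real k)} \<longrightarrow>
      \<bar>Rk \<gamma> g k l1 - Rk \<gamma> g k l2\<bar> \<le> L * \<bar>l1 - l2\<bar>" if a: "0 < a" for a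
  proof (intro exI allI impI)
    fix k :: nat and l1 l2 :: real
    assume k: "1 \<le> k" and l: "l1 \<in> {0..min a (real k)}" "l2 \<in> {0..min a (real k)}"
    define b' where "b' = max 0 (- b)"
    have b': "0 \<le> b'" by (simp add: b'_def)
    have "\<bar>b' * l1\<^sup>2 / real k - b' * l2\<^sup>2 / real k\<bar> = b' * ((l1 + l2) / real k * \<bar>l1 - l2\<bar>)"
      using b' l k by (simp add: power2_eq_square abs_mult square_diff_square_factored
          flip: right_diff_distrib diff_divide_distrib)
    also have "\<dots> \<le> b' * (2 * a * \<bar>l1 - l2\<bar>)"
    \<comment> \<open>Discarding \<open>1 / real k \<le> 1\<close> makes the constant independent of
      \<open>k\<close>.\<close>
    proof (intro mult_left_mono mult_right_mono)
      have "(l1 + l2) / real k \<le> (l1 + l2) / 1"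
        using l k by (intro divide_left_mono) auto
      then show "(l1 + l2) / real k \<le> 2 * a" using l by auto
    qed (use b' in auto)
    finally have "\<bar>b' * l1\<^sup>2 / real k - b' * l2\<^sup>2 / real k\<bar> \<le> b' * (2 * a) * \<bar>l1 - l2\<bar>"
      by (simp add: mult_ac)
    moreover have "\<bar>Rfun b c m l1 - Rfun b c m l2\<bar> \<le> (\<bar>b\<bar> + 2 * c * a + max 1 a * M) * \<bar>l1 - l2\<bar>"
      unfolding M_def using l by (intro Rfun_Lipschitz[OF m_borel m_int' _ _ _ _ c_nonneg]) auto
    moreover have "Rk \<gamma> g k l1 = Rfun b c m l1 + b' * l1\<^sup>2 / real k"
      "Rk \<gamma> g k l2 = Rfun b c m l2 + b' * l2\<^sup>2 / real k"
      using l k by (auto simp: Rk b'_def)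
    ultimately show "\<bar>Rk \<gamma> g k l1 - Rk \<gamma> g k l2\<bar>
        \<le> ((\<bar>b\<bar> + 2 * c * a + max 1 a * M) + max 0 (- b) * (2 * a)) * \<bar>l1 - l2\<bar>"
      unfolding distrib_right[of "_ + _ + max 1 a * M"] b'_def[symmetric] by linarith
  qed

  have Rk_lim: "(\<lambda>k. Rk \<gamma> g k l) \<longlonglongrightarrow> Rfun b c m l" if l: "0 \<le> l" for l
  proof (rule Lim_transform_eventually)
    have "(\<lambda>k. max 0 (- b) * l\<^sup>2 / real k) \<longlonglongrightarrow> 0"
      by (rule lim_const_over_n)
    then show "(\<lambda>k. Rfun b c m l + max 0 (- b) * l\<^sup>2 / real k) \<longlonglongrightarrow> Rfun b c m l"
      using tendsto_add[OF tendsto_const] by fastforce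
    show "\<forall>\<^sub>F k in sequentially. Rfun b c m l + max 0 (- b) * l\<^sup>2 / real k = Rk \<gamma> g k l"
      \<comment> \<open>The exact formula for \<open>Rk\<close> requires
        \<open>l \<le> real k\<close>, which holds from some \<open>k\<close> on.\<close>
      using eventually_ge_at_top[of "max 1 (nat \<lceil>l\<rceil>)"]
      by eventually_elim (use l in \<open>subst Rk; linarith\<close>)
  qed

  \<comment> \<open>Condition (B)\<close>
  have \<delta>_lim: "\<delta> \<longlonglongrightarrow> 0"
    unfolding \<delta>_def[abs_def]
    by (intro tendsto_inverse_0_at_top filterlim_compose[OF sqrt_at_top filterlim_real_sequentially])
  have \<delta>_small: "\<forall>\<^sub>F k in sequentially. B * \<delta> k < e" if "0 < e" for B e
  proof -
    have "(\<lambda>k. B * \<delta> k) \<longlonglongrightarrow> 0" using tendsto_mult_right_zero[OF \<delta>_lim] .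
    then show ?thesis using that by (rule order_tendstoD)
  qed

  have unif: "uniform_limit ({0..a1} \<times> {0..a2}) (\<lambda>k (l, x). Fk \<gamma> h k l x) (\<lambda>(l, x). Ffun \<beta> q \<pi> l x) sequentially"
    if a1: "0 < a1" and a2: "0 < a2" for a1 a2
  proof (rule uniform_limitI)
    fix e :: real assume e: "0 < e"
    \<comment> \<open>An upper bound, over all states up to \<open>a2\<close>, for the total mean of
      drift plus jumps after the shift by \<open>C\<close>.\<close>
    define A where "A = K * (1 + a2) + C"
    have A: "0 \<le> A" using K C a2 by (simp add: A_def)
    \<comment> \<open>Once the grid width \<open>1 / real k\<close> is below \<open>d\<close>,
      monotonicity of \<open>r\<close> makes the discretisation error at most
      \<open>a1 * r d\<close>, less than half of \<open>e\<close>; the other half is left for the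
      change of small jumps.\<close>
    obtain d where d: "0 < d" "r d < e / (2 * a1)"
      using ex_small_value_of_infinite_reciprocal_integral[OF r_inf[of 1], of "e / (2 * a1)"] e a1 by auto
    have "\<forall>\<^sub>F k in sequentially. a1\<^sup>2 * A * \<delta> k < e / 2" using e by (intro \<delta>_small) simp
    moreover have "\<forall>\<^sub>F k in sequentially. A * \<delta> k < C" using C by (intro \<delta>_small)
    moreover have "\<forall>\<^sub>F k in sequentially. k \<ge> max 1 (max (nat \<lceil>a1\<rceil>) (nat \<lceil>1 / d\<rceil>))"
      by (rule eventually_ge_at_top)
    ultimately show "\<forall>\<^sub>F k in sequentially. \<forall>u\<in>{0..a1} \<times> {0..a2}.
        dist (case u of (l, x) \<Rightarrow> Fk \<gamma> h k l x) (case u of (l, x) \<Rightarrow> Ffun \<beta> q \<pi> l x) < e"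
    proof eventually_elim
      case (elim k)
      have k: "1 \<le> k" "a1 \<le> real k" "1 / d \<le> real k" using elim by linarith+
      have kd: "1 / real k \<le> d" using k d by (simp add: field_simps)
      have \<delta>: "0 < \<delta> k" using k by (simp add: \<delta>_def)
      \<comment> \<open>Since \<open>\<gamma> k * \<delta> k * \<delta> k = C\<close>, the eventual
        inequality \<open>A * \<delta> k < C\<close> is the rate condition for all states
        considered, so the fallback law does not occur here.\<close>
      have "\<delta> k * \<delta> k * real k = 1" using k by (simp add: \<delta>_def flip: inverse_mult_distrib)
      then have "\<gamma> k * \<delta> k * \<delta> k = C" by (simp add: \<gamma>_def mult_ac)
      then have "A * \<delta> k \<le> \<gamma> k * \<delta> k * \<delta> k" using elim by simp
      then have A_le: "A \<le> \<gamma> k * \<delta> k" using \<delta> by (simp only: mult_le_cancel_right_pos)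
      show ?case
      proof (clarsimp simp: dist_real_def)
        fix l x assume l: "0 \<le> l" "l \<le> a1" and x: "0 \<le> x" "x \<le> a2"
        define y where "y = real (nat \<lfloor>real k * x\<rfloor>) / real k"
        have y: "0 \<le> y" "y \<le> x" "x - y \<le> 1 / real k"
          using grid[OF k(1) x(1)] by (auto simp: y_def)
        have Ky: "K * (1 + y) + C \<le> A"
          using K x y by (auto simp: A_def intro!: mult_left_mono)
        define G where "G = exp_slope l (\<delta> k) * a y + (\<integral>z. exp_slope l (max z (\<delta> k)) * f y z \<partial>\<pi>)"
        have "\<gamma> k * (1 - pgf (h k (nat \<lfloor>real k * x\<rfloor>)) (1 - l / real k)) = G"
          using h[OF k(1), of "nat \<lfloor>real k * x\<rfloor>" "1 - l / real k"] Ky A_le l k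
          by (simp add: G_def y_def)
        moreover have "\<gamma> k * (l / real k) = C * l" using k by (simp add: \<gamma>_def)
        ultimately have Fk: "Fk \<gamma> h k l x = C * l - G"
          unfolding Fk_def by (simp add: right_diff_distrib)
        have "\<bar>G - (l * a y + (\<integral>z. exp_slope l z * f y z \<partial>\<pi>))\<bar> \<le> l\<^sup>2 * \<delta> k * (a y + integral\<^sup>L \<pi> (f y))"
          unfolding G_def by (intro exp_slope_max_error pi_borel f y l \<delta> f0 f_nn a0)
        also have "\<dots> \<le> a1\<^sup>2 * \<delta> k * A"
          using l \<delta> a_le[OF y(1)] Ky A a1 a0[OF y(1)] f_nn[OF y(1)]
          by (intro mult_mono power_mono) (auto intro!: add_nonneg_nonneg integral_nonneg_AE)
        finally have 1: "\<bar>G - (l * a y + (\<integral>z. exp_slope l z * f y z \<partial>\<pi>))\<bar> < e / 2"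
          using elim by (simp add: mult_ac)
        have "\<bar>(l * \<beta> y + (\<integral>z. exp_slope l z * f y z \<partial>\<pi>)) - (l * \<beta> x + (\<integral>z. exp_slope l z * f x z \<partial>\<pi>))\<bar>
            \<le> l * (\<bar>\<beta> y - \<beta> x\<bar> + (\<integral>z. \<bar>f y z - f x z\<bar> \<partial>\<pi>))"
          by (intro exp_slope_integral_Lipschitz pi_borel f y x l f0)
        also have "\<dots> \<le> l * r \<bar>y - x\<bar>"
          using l f_diff[OF y(1) x(1)] by (intro mult_left_mono)
        also have "\<dots> \<le> a1 * r d"
          using l y kd d r0[of "\<bar>y - x\<bar>"] mono_onD[OF r_mono, of "\<bar>y - x\<bar>" d] by (intro mult_mono) auto
        also have "\<dots> < e / 2"
          using d a1 by (simp add: field_simps)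
        finally have 2: "\<bar>(l * \<beta> y + (\<integral>z. exp_slope l z * f y z \<partial>\<pi>)) - (l * \<beta> x + (\<integral>z. exp_slope l z * f x z \<partial>\<pi>))\<bar> < e / 2" .
        have "Ffun \<beta> q \<pi> l x = - (l * \<beta> x + (\<integral>z. exp_slope l z * f x z \<partial>\<pi>))"
          by (simp add: Ffun_eq f_def)
        moreover have "l * a y = l * \<beta> y + C * l" by (simp add: a_def algebra_simps)
        ultimately show "\<bar>Fk \<gamma> h k l x - Ffun \<beta> q \<pi> l x\<bar> < e"
          using 1 2 unfolding Fk by linarith
      qed
    qed
  qed

  \<comment> \<open>Condition (C)\<close>
  have mean: "ennreal (\<gamma> k / real k) * pgf_left_deriv_1 (h k (nat \<lfloor>real k * x\<rfloor>)) \<le> ennreal ((K + C) * (1 + x))"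
    if x: "0 \<le> x" and k: "1 \<le> k" for x k
  proof -
    define y where "y = real (nat \<lfloor>real k * x\<rfloor>) / real k"
    have y: "0 \<le> y" "y \<le> x" using grid[OF k x] by (auto simp: y_def)
    have \<gamma>: "0 < \<gamma> k" using k C by (simp add: \<gamma>_def)
    have "ennreal (\<gamma> k / real k) * pgf_left_deriv_1 (h k (nat \<lfloor>real k * x\<rfloor>))
        \<le> ennreal (\<gamma> k / real k) * ennreal (real k / \<gamma> k * (K * (1 + y) + C))"
      using h_mean[OF k, of "nat \<lfloor>real k * x\<rfloor>"] by (intro mult_left_mono) (auto simp: y_def)
    also have "\<dots> = ennreal (\<gamma> k / real k * (real k / \<gamma> k * (K * (1 + y) + C)))"
      using \<gamma> K C y by (intro ennreal_mult[symmetric]) auto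
    also have "\<dots> = ennreal (K * (1 + y) + C)"
      using \<gamma> k by simp
    also have "\<dots> \<le> ennreal ((K + C) * (1 + x))"
    proof (rule ennreal_leI)
      have "K * (1 + y) \<le> K * (1 + x)" using y K by (intro mult_left_mono) auto
      moreover have "C * 1 \<le> C * (1 + x)" using C x by (intro mult_left_mono) auto
      ultimately show "K * (1 + y) + C \<le> (K + C) * (1 + x)" by (simp add: distrib_right)
    qed
    finally show ?thesis .
  qed

  have "filterlim \<gamma> at_top sequentially"
    unfolding \<gamma>_def[abs_def]
    by (rule filterlim_tendsto_pos_mult_at_top[OF tendsto_const C(1) filterlim_real_sequentially])
  moreover have "\<forall>k\<ge>1. 0 < \<gamma> k" "\<forall>k\<ge>1. \<gamma> k \<le> \<gamma> (Suc k)"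
    using C by (auto simp: \<gamma>_def)
  moreover have "0 < K + C" using K C by simp
  ultimately show ?thesis
    using Lipschitz Rk_lim unif mean
    by (intro exI[of _ \<gamma>] exI[of _ g] exI[of _ h] conjI exI[of _ "K + C"]) blast+
qed

end
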